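(* Let $d$ and $m$ be positive integers. There is a bijection between the set of rational Dyck paths of type $(m,d)$ and the set of rank $d$ rational Dyck positroids on the ground set $[d+m]$.
   Context: $[n]=\{1,\dots,n\}$. A rational Dyck path of type $(m,d)$ is a lattice path from $(0,0)$ to $(m,d)$ that only uses unit steps $(1,0)$ or $(0,1)$ and never goes above the line $y=(d/m)x$. A $d\times m$ binary matrix $(a_{i,j})$ is a rational Dyck matrix if its zero entries are separated from its one entries by a vertically-reflected rational Dyck path of type $(m,d)$, with the zeros in the upper-right corner; explicitly, there is a rational Dyck path of type $(m,d)$ such that, if $h_j$ is the height ($y$-coordinate) of its $j$-th horizontal step from the left, then $a_{i,j}=0$ if and only if $i\le h_j$. $\mathcal{D}_{d,m}$ denotes the set of all $d\times m$ rational Dyck matrices. The map $\phi_{d,m}\colon \mathrm{Mat}_{d,m}(\mathbb{R})\to \mathrm{Mat}_{d,d+m}(\mathbb{R})$ sends $A=(a_{i,j})$ to the block matrix $(I_d \mid A')$, where $A'$ is the $d\times m$ matrix with $(i,j)$ entry $(-1)^{d-i}a_{d+1-i,j}$. A positroid of rank $d$ on $[n]$ is a matroid represented by a full-rank real $d\times n$ matrix $A$ with nonnegative maximal minors: its bases are the $B\subseteq[n]$ such that the columns of $A$ indexed by $B$ form a basis of $\mathbb{R}^d$. Matrices in $\phi_{d,m}(\mathcal{D}_{d,m})$ have full rank and nonnegative maximal minors; a rank $d$ rational Dyck positroid on $[d+m]$ is a positroid represented by a matrix in $\phi_{d,m}(\mathcal{D}_{d,m})$. *)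

theory Defs
  imports Complex_Main
    "Jordan_Normal_Form.DL_Submatrix"
    "Jordan_Normal_Form.DL_Rank"
begin

(* A lattice path from (0,0) is its word of unit steps: East = (1,0), North = (0,1). *)
datatype step = East | North

(* The constraint is imposed at the lattice points of the path.  This is the constraint on the
   whole path: on each unit step, y - (d/m) x is largest at an endpoint. *)
definition rational_dyck_paths :: "nat \<Rightarrow> nat \<Rightarrow> step list set" where
  "rational_dyck_paths m d =
     {p. count_list p East = m \<and> count_list p North = d \<and>
         (\<forall>k\<le>length p. real (count_list (take k p) North)
                        \<le> (real d / real m) * real (count_list (take k p) East))}"

(* The heights of the horizontal steps, from left to right, of a path starting at height y. *)
fun east_heights :: "nat \<Rightarrow> step list \<Rightarrow> nat list" where
  "east_heights y [] = []"
| "east_heights y (East # p) = y # east_heights y p"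
| "east_heights y (North # p) = east_heights (Suc y) p"

(* Rows and columns of a mat are numbered from 0, so a_{i,j} is A $$ (i - 1, j - 1); with
   zero-based i, the condition i \<le> h_j reads Suc i \<le> h_j. *)
definition rational_dyck_matrices :: "nat \<Rightarrow> nat \<Rightarrow> real mat set" where
  "rational_dyck_matrices d m =
     {A \<in> carrier_mat d m.
        (\<forall>i<d. \<forall>j<m. A $$ (i, j) \<in> {0, 1}) \<and>
        (\<exists>p\<in>rational_dyck_paths m d.
           \<forall>i<d. \<forall>j<m. A $$ (i, j) = 0 \<longleftrightarrow> Suc i \<le> east_heights 0 p ! j)}"

(* The block matrix (I_d | A'), where A' has (i,j) entry (-1)^(d-i) a_{d+1-i,j} in one-based
   indices. *)
definition phi :: "nat \<Rightarrow> nat \<Rightarrow> real mat \<Rightarrow> real mat" where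
  "phi d m A = mat d (d + m) (\<lambda>(i, j).
     if j < d then (if i = j then 1 else 0)
     else (-1) ^ (d - 1 - i) * A $$ (d - 1 - i, j - d))"

(* A pair of a ground set and a set of bases; is_matroid states the basis axioms. *)
type_synonym 'a matroid = "'a set \<times> 'a set set"

definition is_matroid :: "'a matroid \<Rightarrow> bool" where
  "is_matroid M \<longleftrightarrow> (case M of (E, \<B>) \<Rightarrow>
     finite E \<and> \<B> \<subseteq> Pow E \<and> \<B> \<noteq> {} \<and>
     (\<forall>B\<in>\<B>. \<forall>C\<in>\<B>. \<forall>x\<in>B - C. \<exists>y\<in>C - B. insert y (B - {x}) \<in> \<B>))"

(* The column with label j in [n] = {1..n} is col A (j - 1).  Injectivity is needed because the
   columns form a basis as a family: a repeated column must not be counted once. *)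
definition columns_form_basis :: "nat \<Rightarrow> real mat \<Rightarrow> nat set \<Rightarrow> bool" where
  "columns_form_basis d A B \<longleftrightarrow>
     inj_on (\<lambda>j. col A (j - 1)) B \<and>
     vectorspace.basis class_ring (module_vec TYPE(real) d) ((\<lambda>j. col A (j - 1)) ` B)"

definition represents :: "nat \<Rightarrow> nat \<Rightarrow> real mat \<Rightarrow> nat matroid \<Rightarrow> bool" where
  "represents d n A M \<longleftrightarrow>
     A \<in> carrier_mat d n \<and> M = ({1..n}, {B. B \<subseteq> {1..n} \<and> columns_form_basis d A B})"

definition nonneg_maximal_minors :: "nat \<Rightarrow> nat \<Rightarrow> real mat \<Rightarrow> bool" where
  "nonneg_maximal_minors d n A \<longleftrightarrow>
     (\<forall>J. J \<subseteq> {..<n} \<and> card J = d \<longrightarrow> 0 \<le> det (submatrix A UNIV J))"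

definition is_positroid :: "nat \<Rightarrow> nat \<Rightarrow> nat matroid \<Rightarrow> bool" where
  "is_positroid d n M \<longleftrightarrow> is_matroid M \<and>
     (\<exists>A. A \<in> carrier_mat d n \<and> vec_space.rank d A = d \<and> nonneg_maximal_minors d n A \<and>
          represents d n A M)"

definition rational_dyck_positroids :: "nat \<Rightarrow> nat \<Rightarrow> nat matroid set" where
  "rational_dyck_positroids d m =
     {M. is_positroid d (d + m) M \<and>
         (\<exists>A\<in>phi d m ` rational_dyck_matrices d m. represents d (d + m) A M)}"

end

theory Submission
  imports Defs
begin

text \<open>
  The bijection sends a path to the matroid of the columns of \<open>phi\<close> of its Dyck matrix.

  It is injective because the matroid remembers the zero pattern of the matrix. The first \<open>d\<close>
  columns are unit vectors, so exchanging the \<open>r\<close>-th of them for a later column \<open>v\<close> leaves a basis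
  exactly when the \<open>r\<close>-th coordinate of \<open>v\<close> is nonzero
  (\<open>exchanged_unit_columns_form_basis_iff\<close>). The zero pattern gives the height of each horizontal
  step, and these heights determine the path (\<open>east_heights_inject\<close>).

  It is onto by the definition of a rational Dyck positroid, as soon as every matroid obtained in
  this way is known to be a positroid. The basis axioms and the rank are linear algebra. The
  essential point is that the maximal minors are nonnegative, for which the sign changes and the
  reversal of the rows in \<open>phi\<close> are responsible. A column coming from a horizontal step at height
  \<open>h\<close> has alternating entries \<open>1\<close>, \<open>-1\<close> in its top \<open>d - h\<close> rows and zeros below. Adding to each
  row the row below it, a unipotent operation, telescopes this column to a single entry
  \<open>1\<close> or \<open>-1\<close> in its last nonzero row and turns the identity block into a bidiagonal matrix of ones.
  Heights increase along the path, so the single entries move up from left to right. Expanding along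
  these columns from the right, the sign of each entry cancels the sign in the Laplace expansion
  (\<open>minor_with_signed_unit_columns_nonneg\<close>), and what is left is a minor of the bidiagonal matrix,
  which is nonnegative (\<open>bidiagonal_minor_nonneg\<close>).
\<close>

section \<open>Rational Dyck paths and the heights of their horizontal steps\<close>

lemma length_east_heights: "length (east_heights y p) = count_list p East"
  by (induction y p rule: east_heights.induct) auto

lemma east_heights_ge: "h \<in> set (east_heights y p) \<Longrightarrow> y \<le> h"
  by (induction y p rule: east_heights.induct) auto

lemma sorted_east_heights: "sorted (east_heights y p)"
  by (induction y p rule: east_heights.induct) (auto dest: east_heights_ge)

text \<open>
  The prefix ending just before the \<open>j\<close>-th horizontal step (counted from 0) ends at the point
  with abscissa \<open>j\<close> and that step's height. Through it the Dyck condition, which speaks of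
  prefixes, applies to heights.
\<close>
lemma east_heights_nth_prefix:
  assumes "j < length (east_heights y p)"
  shows "\<exists>k\<le>length p. count_list (take k p) East = j \<and>
           y + count_list (take k p) North = east_heights y p ! j"
  using assms
proof (induction y p arbitrary: j rule: east_heights.induct)
  case (1 y)
  then show ?case by simp
next
  case (2 y p)
  show ?case
  proof (cases j)
    case 0
    then show ?thesis by (intro exI[of _ 0]) simp
  next
    case (Suc j')
    with 2 obtain k where "k \<le> length p" "count_list (take k p) East = j'"
      "y + count_list (take k p) North = east_heights y p ! j'" by auto
    with Suc show ?thesis by (intro exI[of _ "Suc k"]) simp
  qed
next
  case (3 y p)
  then obtain k where "k \<le> length p" "count_list (take k p) East = j"
    "Suc y + count_list (take k p) North = east_heights (Suc y) p ! j" by auto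
  then show ?case by (intro exI[of _ "Suc k"]) simp
qed

text \<open>
  The heights determine every step before the last horizontal one; the vertical steps after it are
  only seen by the total number of vertical steps. Two paths cannot differ at their first step: the
  one that goes up has no further horizontal step at the current height \<open>y\<close>.
\<close>
lemma east_heights_inject:
  assumes "east_heights y p = east_heights y q" "count_list p North = count_list q North"
  shows "p = q"
  using assms
proof (induction y p arbitrary: q rule: east_heights.induct)
  case (1 y)
  have "count_list q East = 0"
    using 1 length_east_heights[of y q] by simp
  moreover have "count_list q North = 0"
    using 1 by simp
  ultimately have "s \<notin> set q" for s
    by (cases s) (auto simp: count_list_0_iff)
  then show ?case by (cases q) auto
next
  case (2 y p)
  show ?case
  proof (cases q)
    case Nil
    with 2 show ?thesis by simp
  next
    case (Cons s q')
    show ?thesis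
    proof (cases s)
      case East
      with 2 Cons show ?thesis by auto
    next
      case North
      with 2 Cons have "y \<in> set (east_heights (Suc y) q')"
        by (metis east_heights.simps(2,3) list.set_intros(1))
      then show ?thesis using east_heights_ge by fastforce
    qed
  qed
next
  case (3 y p)
  show ?case
  proof (cases q)
    case Nil
    with 3 show ?thesis by simp
  next
    case (Cons s q')
    show ?thesis
    proof (cases s)
      case North
      with 3 Cons show ?thesis by auto
    next
      case East
      with 3 Cons have "y \<in> set (east_heights (Suc y) p)"
        by (metis east_heights.simps(2,3) list.set_intros(1))
      then show ?thesis using east_heights_ge by fastforce
    qed
  qed
qed

text \<open>
  Horizontal steps start strictly left of \<open>x = m\<close>, where the diagonal is still below \<open>d\<close>.
  Hence no column of a Dyck matrix is zero, and each height can be read off its column.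
\<close>
lemma rational_dyck_path_east_height_less:
  assumes p: "p \<in> rational_dyck_paths m d" and "d > 0" and j: "j < m"
  shows "east_heights 0 p ! j < d"
proof -
  have "j < length (east_heights 0 p)"
    using p j by (simp add: length_east_heights rational_dyck_paths_def)
  then obtain k where k: "k \<le> length p" "count_list (take k p) East = j"
      "count_list (take k p) North = east_heights 0 p ! j"
    using east_heights_nth_prefix[of j 0 p] by auto
  then have "real (east_heights 0 p ! j) \<le> real d / real m * real j"
    using p by (auto simp: rational_dyck_paths_def)
  also have "\<dots> < real d"
    using \<open>d > 0\<close> j by (simp add: field_simps)
  finally show ?thesis by simp
qed

definition staircase_mat :: "nat \<Rightarrow> nat \<Rightarrow> (nat \<Rightarrow> nat) \<Rightarrow> real mat" where
  "staircase_mat d m h = mat d m (\<lambda>(i, j). if i < h j then 0 else 1)"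

abbreviation dyck_mat :: "nat \<Rightarrow> nat \<Rightarrow> step list \<Rightarrow> real mat" where
  "dyck_mat d m p \<equiv> staircase_mat d m (\<lambda>j. east_heights 0 p ! j)"

text \<open>The entries are 0 or 1, so the zero pattern prescribed by a path fixes the matrix.\<close>
lemma rational_dyck_matrices_eq:
  "rational_dyck_matrices d m = dyck_mat d m ` rational_dyck_paths m d"
proof
  show "rational_dyck_matrices d m \<subseteq> dyck_mat d m ` rational_dyck_paths m d"
  proof
    fix A assume A: "A \<in> rational_dyck_matrices d m"
    then obtain p where p: "p \<in> rational_dyck_paths m d"
      "\<forall>i<d. \<forall>j<m. A $$ (i, j) = 0 \<longleftrightarrow> Suc i \<le> east_heights 0 p ! j"
      by (auto simp: rational_dyck_matrices_def)
    have "A = dyck_mat d m p"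
      using A p(2) by (intro eq_matI)
        (auto simp: rational_dyck_matrices_def staircase_mat_def Suc_le_eq)
    with p(1) show "A \<in> dyck_mat d m ` rational_dyck_paths m d" by blast
  qed
  show "dyck_mat d m ` rational_dyck_paths m d \<subseteq> rational_dyck_matrices d m"
    by (auto simp: rational_dyck_matrices_def staircase_mat_def Suc_le_eq split: if_splits)
qed

lemma phi_carrier: "phi d m A \<in> carrier_mat d (d + m)"
  by (simp add: phi_def)

lemma phi_unit_columns: "j < d \<Longrightarrow> col (phi d m A) j = unit_vec d j"
  by (intro eq_vecI) (auto simp: phi_def unit_vec_def)

lemma phi_staircase_index:
  assumes "i < d" "j < m"
  shows "phi d m (staircase_mat d m h) $$ (i, d + j) = (if i + h j < d then (-1) ^ (d - 1 - i) else 0)"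
  using assms by (auto simp: phi_def staircase_mat_def)

section \<open>Nonnegative maximal minors\<close>

text \<open>
  A bidiagonal matrix of ones is totally nonnegative. In a minor with rows \<open>r\<close> and columns \<open>c\<close>, if
  the last column index is at most the last row index, the last row vanishes before its last
  entry; otherwise the last column vanishes above its last entry. Either way the minor is the
  product of its last diagonal entry, which is 0 or 1, and a smaller minor of the same kind.
\<close>
lemma bidiagonal_minor_nonneg:
  fixes r c :: "nat \<Rightarrow> nat"
  assumes "strict_mono_on {..<n} r" "strict_mono_on {..<n} c"
  shows "0 \<le> det (mat n n (\<lambda>(i, j). if c j = r i \<or> c j = Suc (r i) then 1 else 0 :: real))"
  using assms
proof (induction n)
  case 0
  then show ?case by simp
next
  case (Suc n)
  define M where "M = mat (Suc n) (Suc n)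
    (\<lambda>(i, j). if c j = r i \<or> c j = Suc (r i) then 1 else 0 :: real)"
  define N where "N = mat n n (\<lambda>(i, j). if c j = r i \<or> c j = Suc (r i) then 1 else 0 :: real)"
  have M: "M \<in> carrier_mat (Suc n) (Suc n)" by (simp add: M_def)
  have N: "0 \<le> det N"
    unfolding N_def using Suc.prems by (intro Suc.IH) (auto simp: monotone_on_def)
  have r: "r i < r n" and c: "c i < c n" if "i < n" for i
    using Suc.prems that by (auto simp: strict_mono_on_def)
  have del: "mat_delete M n n = N"
    by (rule eq_matI) (auto simp: mat_delete_def M_def N_def)
  have corner: "0 \<le> M $$ (n, n) * cofactor M n n"
    using N by (simp add: cofactor_def del) (simp add: M_def)
  show ?case
  proof (cases "c n \<le> r n")
    case True
    have "det M = (\<Sum>j<Suc n. M $$ (n, j) * cofactor M n j)"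
      using laplace_expansion_row[OF M, of n] by simp
    also have "\<dots> = M $$ (n, n) * cofactor M n n"
    proof -
      have "M $$ (n, j) = 0" if "j < n" for j
        using c[OF that] True that by (auto simp: M_def)
      then show ?thesis by simp
    qed
    finally show ?thesis using corner by (simp add: M_def)
  next
    case False
    have "det M = (\<Sum>i<Suc n. M $$ (i, n) * cofactor M i n)"
      using laplace_expansion_column[OF M, of n] by simp
    also have "\<dots> = M $$ (n, n) * cofactor M n n"
    proof -
      have "M $$ (i, n) = 0" if "i < n" for i
        using r[OF that] False that by (auto simp: M_def)
      then show ?thesis by simp
    qed
    finally show ?thesis using corner by (simp add: M_def)
  qed
qed

text \<open>
  Induction on the number \<open>q\<close> of appended columns, expanding along the last one. Its nonzero entry
  is in row \<open>s j\<close>, with a sign equal to that of the cofactor, so the determinant is that of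
  the matrix without this row and column. Since \<open>s\<close> is weakly decreasing, the other appended
  columns either repeat the last one, and the determinant is 0, or have their entry further down.
  In that case deleting the row moves their entry up by one while the matrix shrinks by one, so
  the distance to the bottom row, on which the sign depends, is unchanged. The row selection \<open>r\<close> is
  needed because the rows of \<open>P\<close> that survive the deletions are no longer consecutive.
\<close>
lemma minor_with_signed_unit_columns_nonneg:
  fixes P :: "nat \<Rightarrow> nat \<Rightarrow> real" and r c s :: "nat \<Rightarrow> nat"
  assumes tn: "\<And>r. strict_mono_on {..<k} r \<Longrightarrow> 0 \<le> det (mat k k (\<lambda>(i, j). P (r i) (c j)))"
    and r: "strict_mono_on {..<k + q} r"
    and s: "\<And>j j'. k \<le> j \<Longrightarrow> j \<le> j' \<Longrightarrow> j' < k + q \<Longrightarrow> s j' \<le> s j"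
  shows "0 \<le> det (mat (k + q) (k + q) (\<lambda>(i, j). if j < k then P (r i) (c j)
           else if i = s j then (-1) ^ (k + q - 1 - i) else 0))"
  using r s
proof (induction q arbitrary: r s)
  case 0
  have "mat (k + 0) (k + 0) (\<lambda>(i, j). if j < k then P (r i) (c j)
          else if i = s j then (-1) ^ (k + 0 - 1 - i) else 0)
        = mat k k (\<lambda>(i, j). P (r i) (c j))"
    by (rule eq_matI) auto
  then show ?case using tn[of r] 0 by simp
next
  case (Suc q)
  define n where "n = k + q"
  define t where "t = s n"
  define M where "M = mat (Suc n) (Suc n) (\<lambda>(i, j). if j < k then P (r i) (c j)
           else if i = s j then (-1) ^ (n - i) else 0)"
  have M: "M \<in> carrier_mat (Suc n) (Suc n)" by (simp add: M_def)
  have "0 \<le> det M"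
  proof -
    consider "t > n" | j where "k \<le> j" "j < n" "s j = t"
      | "t \<le> n" "\<And>j. k \<le> j \<Longrightarrow> j < n \<Longrightarrow> s j \<noteq> t" by force
    then show ?thesis
    proof cases
      \<comment> \<open>An index beyond the last row encodes a zero column.\<close>
      case 1
      have "det M = (\<Sum>i<Suc n. M $$ (i, n) * cofactor M i n)"
        using laplace_expansion_column[OF M, of n] by simp
      also have "\<dots> = 0"
        using 1 by (intro sum.neutral) (auto simp: M_def n_def t_def)
      finally show ?thesis by simp
    next
      case 2
      then have "col M j = col M n"
        by (intro eq_vecI) (auto simp: M_def n_def t_def)
      then show ?thesis
        using det_identical_columns[OF M, of j n] 2 by simp
    next
      case 3
      have gt: "t < s j" if "k \<le> j" "j < n" for j
        using 3(2)[OF that] Suc.prems(2)[of j n] that by (simp add: n_def t_def)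
      define r' where "r' i = r (if i < t then i else Suc i)" for i
      define s' where "s' j = s j - 1" for j
      have "det M = (\<Sum>i<Suc n. M $$ (i, n) * cofactor M i n)"
        using laplace_expansion_column[OF M, of n] by simp
      also have "\<dots> = (\<Sum>i<Suc n. if i = t then M $$ (t, n) * cofactor M t n else 0)"
        by (intro sum.cong) (auto simp: M_def n_def t_def)
      also have "\<dots> = M $$ (t, n) * cofactor M t n"
        using 3(1) by simp
      also have "\<dots> = (-1) ^ (n - t) * (-1) ^ (t + n) * det (mat_delete M t n)"
        using 3(1) by (simp add: cofactor_def M_def n_def t_def)
      also have "\<dots> = det (mat_delete M t n)"
      proof -
        have "(-1) ^ (n - t) * (-1) ^ (t + n) = (1 :: real)"
          using 3(1) by (simp flip: power_add)
        then show ?thesis by simp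
      qed
      also have "mat_delete M t n = mat n n (\<lambda>(i, j). if j < k then P (r' i) (c j)
           else if i = s' j then (-1) ^ (n - 1 - i) else 0)" (is "_ = ?N")
      proof (rule eq_matI)
        fix i j assume "i < dim_row ?N" "j < dim_col ?N"
        then have ij: "i < n" "j < n" by auto
        have *: "(if i < t then i else Suc i) = s j \<longleftrightarrow> i = s' j \<and> \<not> i < t" if "k \<le> j"
          using gt[OF that ij(2)] by (auto simp: s'_def)
        have "\<not> i < t" if "k \<le> j" "i = s' j"
          using gt[OF that(1) ij(2)] that(2) by (auto simp: s'_def)
        with * ij show "mat_delete M t n $$ (i, j) = ?N $$ (i, j)"
          by (auto simp: mat_delete_def M_def r'_def)
      qed (simp_all add: mat_delete_def M_def)
      also have "0 \<le> det \<dots>"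
        unfolding n_def
      proof (rule Suc.IH)
        show "strict_mono_on {..<k + q} r'"
          using Suc.prems(1) by (auto simp: strict_mono_on_def r'_def)
        show "s' j' \<le> s' j" if "k \<le> j" "j \<le> j'" "j' < k + q" for j j'
          using Suc.prems(2)[of j j'] that by (simp add: s'_def)
      qed
      finally show ?thesis .
    qed
  qed
  moreover have "k + Suc q = Suc n" "Suc n - 1 - i = n - i" for i by (simp_all add: n_def)
  ultimately show ?case by (simp only: M_def)
qed

text \<open>
  The choice \<open>J\<close> of columns takes \<open>k\<close> of them from the identity block. After adding to each row the
  row below it, these are columns of the bidiagonal matrix and each of the others has a single
  nonzero entry, in row \<open>s j\<close>.
\<close>
lemma phi_staircase_nonneg_maximal_minors:
  assumes mono: "\<And>j j'. j \<le> j' \<Longrightarrow> j' < m \<Longrightarrow> h j \<le> h j'" and less: "\<And>j. j < m \<Longrightarrow> h j < d"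
  shows "nonneg_maximal_minors d (d + m) (phi d m (staircase_mat d m h))"
  unfolding nonneg_maximal_minors_def
proof (intro allI impI, elim conjE)
  fix J :: "nat set" assume J: "J \<subseteq> {..<d + m}" and card: "card J = d"
  define A where "A = phi d m (staircase_mat d m h)"
  define c where "c = pick J"
  define k where "k = card {a. a < d \<and> a \<in> J}"
  define s where "s j = d - 1 - h (c j - d)" for j
  have finJ: "finite J" using J finite_subset by blast
  have c_in: "c j < d + m" if "j < d" for j
    using pick_in_set_le[of j J] J card that by (auto simp: c_def)
  have c_mono: "strict_mono_on {..<d} c"
    using card by (auto simp: strict_mono_on_def c_def intro: pick_mono_le)
  have k_le: "k \<le> d"
    unfolding k_def card[symmetric] using finJ by (intro card_mono) auto
  have c_less: "c j < d \<longleftrightarrow> j < k" if "j < d" for j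
  proof
    assume "j < k"
    then show "c j < d" unfolding c_def k_def by (rule pick_le)
  next
    assume "c j < d"
    have "Suc j = card (insert (c j) {a \<in> J. a < c j})"
      using card_pick_le[of j J] card that finJ by (simp add: c_def)
    also have "\<dots> \<le> k"
      unfolding k_def using \<open>c j < d\<close> pick_in_set_le[of j J] card that
      by (intro card_mono) (auto simp: c_def)
    finally show "j < k" by simp
  qed
  \<comment> \<open>\<open>U\<close> adds to each row the row below it, and \<open>R\<close> is the result.\<close>
  define S where "S = submatrix A UNIV J"
  define U where "U = mat d d (\<lambda>(i, k). if k = i \<or> k = Suc i then 1 else 0 :: real)"
  define R where "R = mat d d (\<lambda>(i, j). if j < k then (if c j = i \<or> c j = Suc i then 1 else 0)
     else if i = s j then (-1) ^ (d - 1 - i) else 0 :: real)"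
  have A: "A \<in> carrier_mat d (d + m)" by (simp add: A_def phi_carrier)
  have "{j. j < d + m \<and> j \<in> J} = J" using J by auto
  then have S: "S = mat d d (\<lambda>(i, j). A $$ (i, c j))"
    using A card by (auto simp: S_def submatrix_def c_def pick_UNIV)
  have U: "U \<in> carrier_mat d d" by (simp add: U_def)
  have "det U = 1"
  proof -
    have "upper_triangular U" by (auto simp: U_def)
    then have "det U = prod_list (diag_mat U)" using U by (rule det_upper_triangular)
    also have "diag_mat U = map (\<lambda>i. 1) [0..<d]" by (auto simp: diag_mat_def U_def)
    also have "prod_list \<dots> = (1 :: real)" by (induction d) auto
    finally show ?thesis .
  qed
  have "U * S = R"
  proof (rule eq_matI)
    fix i j assume "i < dim_row R" "j < dim_col R"
    then have ij: "i < d" "j < d" by (auto simp: R_def)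
    have "(U * S) $$ (i, j) = (\<Sum>l<d. U $$ (i, l) * S $$ (l, j))"
      using ij U by (simp add: S scalar_prod_def atLeast0LessThan)
    also have "\<dots> = (\<Sum>l<d. (if l = i then A $$ (i, c j) else 0)
                       + (if l = Suc i then A $$ (Suc i, c j) else 0))"
      using ij by (intro sum.cong) (auto simp: U_def S)
    also have "\<dots> = A $$ (i, c j) + (if Suc i < d then A $$ (Suc i, c j) else 0)"
      using ij by (simp add: sum.distrib)
    also have "\<dots> = R $$ (i, j)"
    proof (cases "j < k")
      case True
      then have "c j < d" using c_less ij by simp
      then show ?thesis using True ij by (auto simp: A_def phi_def R_def)
    next
      case False
      then have "\<not> c j < d" using c_less ij by simp
      then obtain j' where j': "c j = d + j'" using le_Suc_ex not_less by blast
      then have "j' < m" using c_in[OF ij(2)] by simp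
      have idx: "A $$ (i', c j) = (if i' + h j' < d then (-1) ^ (d - 1 - i') else 0)" if "i' < d" for i'
        using phi_staircase_index[OF that \<open>j' < m\<close>] by (simp add: A_def j')
      have sj: "s j = d - 1 - h j'" by (simp add: s_def j')
      have R: "R $$ (i, j) = (if i = s j then (-1) ^ (d - 1 - i) else 0)"
        using ij False by (simp add: R_def)
      consider "Suc i + h j' < d" | "Suc i + h j' = d" | "Suc i + h j' > d" by linarith
      then show ?thesis
      proof cases
        case 1
        then have "d - 1 - i = Suc (d - 1 - Suc i)" by simp
        with 1 show ?thesis unfolding R sj by (auto simp: idx ij)
      next
        case 2
        then have "i = s j" "i + h j' < d" by (auto simp: sj)
        with 2 show ?thesis unfolding R by (auto simp: idx ij)
      next
        case 3
        then have "i \<noteq> s j" using less[OF \<open>j' < m\<close>] by (auto simp: sj)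
        with 3 show ?thesis unfolding R by (auto simp: idx ij)
      qed
    qed
    finally show "(U * S) $$ (i, j) = R $$ (i, j)" .
  qed (simp_all add: R_def U_def S)
  then have "det R = det U * det S"
    using det_mult[OF U, of S] by (simp add: S)
  then have "det S = det R" using \<open>det U = 1\<close> by simp
  also have "0 \<le> det R"
  proof -
    have "0 \<le> det (mat (k + (d - k)) (k + (d - k)) (\<lambda>(i, j). if j < k
        then (\<lambda>a b. if b = a \<or> b = Suc a then 1 else 0) (id i) (c j)
        else if i = s j then (-1) ^ (k + (d - k) - 1 - i) else 0 :: real))"
    proof (rule minor_with_signed_unit_columns_nonneg)
      show "0 \<le> det (mat k k (\<lambda>(i, j). if c j = r i \<or> c j = Suc (r i) then 1 else 0 :: real))"
        if "strict_mono_on {..<k} r" for r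
        using that c_mono k_le
        by (intro bidiagonal_minor_nonneg) (auto simp: monotone_on_def)
      show "strict_mono_on {..<k + (d - k)} id" by (simp add: strict_mono_on_def)
      show "s j' \<le> s j" if "k \<le> j" "j \<le> j'" "j' < k + (d - k)" for j j'
      proof -
        have d: "j < d" "j' < d" using that by auto
        have "c j \<le> c j'"
          using c_mono that d by (cases "j = j'") (auto simp: strict_mono_on_def intro: less_imp_le)
        moreover have "d \<le> c j"
          using c_less[OF d(1)] that(1) by simp
        moreover have "c j' < d + m" using c_in d(2) by simp
        ultimately have "h (c j - d) \<le> h (c j' - d)"
          by (intro mono) auto
        then show ?thesis by (simp add: s_def)
      qed
    qed
    moreover have "k + (d - k) = d" using k_le by simp
    ultimately show ?thesis by (simp only: R_def id_apply)
  qed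
  finally show "0 \<le> det (submatrix (phi d m (staircase_mat d m h)) UNIV J)"
    by (simp add: S_def A_def)
qed

section \<open>The matroid of the columns of a matrix\<close>

text \<open>
  The basis is the image of an index set, since columns with different labels may be equal.
  A vector outside the span of the remaining ones keeps the family independent, and the number of
  its members is again the dimension.
\<close>
lemma (in vec_space) indexed_basis_exchange:
  assumes inj: "inj_on v B" and basis: "basis (v ` B)" and x: "x \<in> B"
    and vy: "v y \<in> carrier_vec n" "v y \<notin> span (v ` (B - {x}))"
  shows "inj_on v (insert y (B - {x})) \<and> basis (v ` insert y (B - {x}))"
proof -
  let ?W = "v ` (B - {x})"
  have li: "lin_indpt (v ` B)" and carr: "v ` B \<subseteq> carrier_vec n"
    using basis by (auto simp: basis_def)
  have fin: "finite (v ` B)" by (rule li_le_dim(1)[OF fin_dim carr li])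
  then have finB: "finite B" using inj finite_imageD by blast
  have W: "?W \<subseteq> carrier_vec n" "lin_indpt ?W"
    using carr subset_li_is_li[OF li, of ?W] by auto
  have notin: "v y \<notin> ?W" using vy(2) in_own_span[OF W(1)] by blast
  have li': "lin_indpt (insert (v y) ?W)"
    using lin_dep_iff_in_span[OF W vy(1) notin] vy(2) by simp
  have inj': "inj_on v (insert y (B - {x}))"
    unfolding inj_on_insert
  proof
    show "inj_on v (B - {x})" using inj by (rule inj_on_subset) blast
    show "v y \<notin> v ` (B - {x} - {y})" using notin by (metis image_mono Diff_subset subsetD)
  qed
  have "y \<notin> B - {x}" using notin by (metis imageI)
  then have "card (insert y (B - {x})) = card B"
    using finB card_Suc_Diff1[OF finB x] by simp
  then have "card (v ` insert y (B - {x})) = card (v ` B)"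
    by (simp only: card_image[OF inj] card_image[OF inj'])
  also have "\<dots> = dim" by (rule dim_basis[OF fin basis, symmetric])
  finally have "basis (v ` insert y (B - {x}))"
    using finB W(1) vy(1) li' by (intro dim_li_is_basis[OF fin_dim]) auto
  with inj' show ?thesis by (rule conjI)
qed

definition column_bases :: "nat \<Rightarrow> nat \<Rightarrow> real mat \<Rightarrow> nat set set" where
  "column_bases d n A = {B. B \<subseteq> {1..n} \<and> columns_form_basis d A B}"

text \<open>
  Some column of \<open>C\<close> lies outside the span of \<open>B - {x}\<close>, for otherwise this span would be the whole
  space and contain the column \<open>x\<close>, against independence. That column can replace \<open>x\<close>.
\<close>
lemma is_matroid_column_bases:
  assumes A: "A \<in> carrier_mat d n" and ne: "column_bases d n A \<noteq> {}"
  shows "is_matroid ({1..n}, column_bases d n A)"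
proof -
  interpret vec_space "TYPE(real)" d .
  let ?v = "\<lambda>j. col A (j - 1)"
  have "\<exists>y\<in>C - B. insert y (B - {x}) \<in> column_bases d n A"
    if B: "B \<in> column_bases d n A" and C: "C \<in> column_bases d n A" and x: "x \<in> B - C" for B C x
  proof -
    let ?W = "?v ` (B - {x})"
    have injB: "inj_on ?v B" and bB: "basis (?v ` B)" and B_sub: "B \<subseteq> {1..n}"
      using B by (auto simp: column_bases_def columns_form_basis_def)
    have bC: "basis (?v ` C)" and C_sub: "C \<subseteq> {1..n}"
      using C by (auto simp: column_bases_def columns_form_basis_def)
    have carr: "?v j \<in> carrier_vec d" for j using A by (auto simp: col_def)
    have liB: "lin_indpt (?v ` B)" using bB by (simp add: basis_def)
    have W: "?W \<subseteq> carrier_vec d" "lin_indpt ?W"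
      using carr subset_li_is_li[OF liB, of ?W] by auto
    have "?v x \<notin> ?W" using injB x by (auto simp: inj_on_def)
    moreover have "?W \<union> {?v x} = ?v ` B" using x by auto
    ultimately have x_span: "?v x \<notin> span ?W"
      using lin_dep_iff_in_span[OF W carr] liB by metis
    have "\<not> ?v ` C \<subseteq> span ?W"
    proof
      assume "?v ` C \<subseteq> span ?W"
      then have "span (?v ` C) \<subseteq> span ?W" by (rule span_subsetI[OF W(1)])
      then show False using bC carr x_span by (auto simp: basis_def)
    qed
    then obtain y where y: "y \<in> C" "?v y \<notin> span ?W" by blast
    have "y \<notin> B"
      using y x in_own_span[OF W(1)] by blast
    moreover have "insert y (B - {x}) \<in> column_bases d n A"
      using indexed_basis_exchange[OF injB bB _ carr y(2)] x y(1) B_sub C_sub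
      by (auto simp: column_bases_def columns_form_basis_def)
    ultimately show ?thesis using y(1) by blast
  qed
  then show ?thesis
    using ne by (auto simp: is_matroid_def column_bases_def)
qed

lemma submodule_coordinate_zero:
  assumes "r < d"
  shows "LinearCombinations.submodule class_ring {w \<in> carrier_vec d. w $ r = 0}
           (module_vec TYPE(real) d)"
proof -
  interpret vec_space "TYPE(real)" d .
  show ?thesis
    using assms by (intro LinearCombinations.submodule.intro) (auto intro: module_axioms)
qed

lemma unit_columns_form_basis:
  assumes unit: "\<And>j. j < d \<Longrightarrow> col A j = unit_vec d j"
  shows "columns_form_basis d A {1..d}"
proof -
  interpret vec_space "TYPE(real)" d .
  have "(\<lambda>j. col A (j - 1)) ` {1..d} = (\<lambda>j. col A j) ` {..<d}"
    by (force simp: image_iff intro: bexI[of _ "Suc _"])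
  also have "\<dots> = set (unit_vecs d)"
    using unit by (auto simp: unit_vecs_def)
  finally have "basis ((\<lambda>j. col A (j - 1)) ` {1..d})" using unit_vecs_basis by simp
  moreover have "inj_on (\<lambda>j. col A (j - 1)) {1..d}"
    using unit by (auto simp: inj_on_def)
  ultimately show ?thesis by (simp add: columns_form_basis_def)
qed

lemma rank_unit_columns:
  fixes A :: "real mat"
  assumes A: "A \<in> carrier_mat d (d + m)" and unit: "\<And>j. j < d \<Longrightarrow> col A j = unit_vec d j"
  shows "vec_space.rank d A = d"
proof -
  interpret vec_space "TYPE(real)" d .
  have cols: "set (cols A) \<subseteq> carrier_vec d" using cols_dim[of A] A by simp
  have "set (unit_vecs d :: real vec list) \<subseteq> set (cols A)"
  proof
    fix w :: "real vec" assume "w \<in> set (unit_vecs d)"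
    then obtain j where j: "j < d" "w = unit_vec d j" by (auto simp: unit_vecs_def)
    then have "w = cols A ! j" "j < length (cols A)" using A unit[OF j(1)] by auto
    then show "w \<in> set (cols A)" by (metis nth_mem)
  qed
  from span_is_monotone[OF this] have "carrier_vec d \<subseteq> span (set (cols A))"
    by (simp only: span_unit_vecs_is_carrier)
  then have "span (set (cols A)) = carrier_vec d"
    by (rule subset_antisym[OF span_is_subset2[OF cols]])
  moreover have "vs (carrier_vec d) = V" by (simp add: module_vec_def)
  ultimately show ?thesis by (simp only: rank_def dim_is_n)
qed

text \<open>
  The unit vectors other than the \<open>r\<close>-th lie in the hyperplane where the \<open>r\<close>-th coordinate vanishes.
  If the new column also lies there, the family cannot span the space; if not, it is outside the
  span of the others and can replace the \<open>r\<close>-th unit vector. Labels of columns start at 1 and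
  indices at 0, hence the successors.
\<close>
lemma exchanged_unit_columns_form_basis_iff:
  assumes A: "A \<in> carrier_mat d (d + m)" and unit: "\<And>j. j < d \<Longrightarrow> col A j = unit_vec d j"
    and r: "r < d" and j: "j < m"
  shows "columns_form_basis d A (insert (Suc (d + j)) ({1..d} - {Suc r})) \<longleftrightarrow> A $$ (r, d + j) \<noteq> 0"
proof -
  interpret vec_space "TYPE(real)" d .
  let ?v = "\<lambda>j. col A (j - 1)"
  let ?W = "{w \<in> carrier_vec d. w $ r = 0}"
  have W: "span X \<subseteq> ?W" if "X \<subseteq> ?W" for X
    using that submodule_coordinate_zero[OF r] by (rule span_is_subset)
  have others: "?v ` ({1..d} - {Suc r}) \<subseteq> ?W"
    using unit r by auto
  have vj: "?v (Suc (d + j)) \<in> carrier_vec d" "?v (Suc (d + j)) $ r = A $$ (r, d + j)"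
    using A r j by auto
  show ?thesis
  proof
    assume "columns_form_basis d A (insert (Suc (d + j)) ({1..d} - {Suc r}))"
    then have "unit_vec d r \<in> span (?v ` (insert (Suc (d + j)) ({1..d} - {Suc r})))"
      by (auto simp: columns_form_basis_def basis_def)
    moreover have "unit_vec d r \<notin> ?W" using r by simp
    ultimately have "\<not> ?v ` (insert (Suc (d + j)) ({1..d} - {Suc r})) \<subseteq> ?W"
      using W by blast
    then show "A $$ (r, d + j) \<noteq> 0" using others vj by auto
  next
    assume "A $$ (r, d + j) \<noteq> 0"
    then have "?v (Suc (d + j)) \<notin> span (?v ` ({1..d} - {Suc r}))"
      using W[OF others] vj(2) by auto
    then show "columns_form_basis d A (insert (Suc (d + j)) ({1..d} - {Suc r}))"
      using indexed_basis_exchange[of ?v "{1..d}" "Suc r" "Suc (d + j)"] r vj(1)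
        unit_columns_form_basis[OF unit]
      by (simp add: columns_form_basis_def)
  qed
qed

section \<open>The bijection\<close>

definition dyck_positroid :: "nat \<Rightarrow> nat \<Rightarrow> step list \<Rightarrow> nat matroid" where
  "dyck_positroid d m p = ({1..d + m}, column_bases d (d + m) (phi d m (dyck_mat d m p)))"

lemma represents_phi_iff:
  "represents d (d + m) (phi d m A) M \<longleftrightarrow> M = ({1..d + m}, column_bases d (d + m) (phi d m A))"
  by (simp add: represents_def phi_carrier column_bases_def)

lemma dyck_positroid_is_positroid:
  assumes "d > 0" and p: "p \<in> rational_dyck_paths m d"
  shows "is_positroid d (d + m) (dyck_positroid d m p)"
proof -
  let ?A = "phi d m (dyck_mat d m p)"
  have "{1..d} \<in> column_bases d (d + m) ?A"
    using unit_columns_form_basis[OF phi_unit_columns, of d m] by (simp add: column_bases_def)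
  then have "is_matroid (dyck_positroid d m p)"
    unfolding dyck_positroid_def by (intro is_matroid_column_bases phi_carrier) auto
  moreover have "vec_space.rank d ?A = d"
    by (rule rank_unit_columns[OF phi_carrier phi_unit_columns])
  moreover have "nonneg_maximal_minors d (d + m) ?A"
  proof (rule phi_staircase_nonneg_maximal_minors)
    have "length (east_heights 0 p) = m"
      using p by (simp add: length_east_heights rational_dyck_paths_def)
    then show "east_heights 0 p ! j \<le> east_heights 0 p ! j'" if "j \<le> j'" "j' < m" for j j'
      using sorted_nth_mono[OF sorted_east_heights] that by simp
    show "east_heights 0 p ! j < d" if "j < m" for j
      using rational_dyck_path_east_height_less[OF p \<open>d > 0\<close> that] .
  qed
  ultimately show ?thesis
    unfolding is_positroid_def
    by (intro conjI exI[of _ ?A]) (simp_all add: phi_carrier represents_phi_iff dyck_positroid_def)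
qed

text \<open>A matrix determines the matroid that it represents, so no other Dyck positroids exist.\<close>
lemma rational_dyck_positroids_eq:
  assumes "d > 0"
  shows "rational_dyck_positroids d m = dyck_positroid d m ` rational_dyck_paths m d"
  using dyck_positroid_is_positroid[OF assms]
  by (auto simp: rational_dyck_positroids_def rational_dyck_matrices_eq represents_phi_iff
      dyck_positroid_def)

lemma inj_on_dyck_positroid:
  assumes "d > 0"
  shows "inj_on (dyck_positroid d m) (rational_dyck_paths m d)"
proof (rule inj_onI)
  fix p q assume p: "p \<in> rational_dyck_paths m d" and q: "q \<in> rational_dyck_paths m d"
    and eq: "dyck_positroid d m p = dyck_positroid d m q"
  have zeros: "r + east_heights 0 p' ! j < d \<longleftrightarrow>
      insert (Suc (d + j)) ({1..d} - {Suc r}) \<in> snd (dyck_positroid d m p')"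
    if "r < d" "j < m" for r j p'
  proof -
    have "insert (Suc (d + j)) ({1..d} - {Suc r}) \<subseteq> {1..d + m}" using that by auto
    then show ?thesis
      using exchanged_unit_columns_form_basis_iff[OF phi_carrier phi_unit_columns that]
        phi_staircase_index[OF that]
      by (auto simp: dyck_positroid_def column_bases_def split: if_splits)
  qed
  \<comment> \<open>Row \<open>d - 1 - h\<close> is the last nonzero one of a column with height \<open>h\<close>; comparing the two columns in
      the rows belonging to both heights yields one inequality each.\<close>
  have "east_heights 0 p ! j = east_heights 0 q ! j" if j: "j < m" for j
  proof -
    let ?a = "east_heights 0 p ! j" and ?b = "east_heights 0 q ! j"
    have ab: "?a < d" "?b < d"
      using rational_dyck_path_east_height_less[OF _ assms j] p q by auto
    have "r + ?a < d \<longleftrightarrow> r + ?b < d" if "r < d" for r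
      using zeros[OF that j] eq by simp
    from this[of "d - 1 - ?a"] this[of "d - 1 - ?b"] ab show ?thesis by auto
  qed
  moreover have "length (east_heights 0 p) = m" "length (east_heights 0 q) = m"
    using p q by (auto simp: length_east_heights rational_dyck_paths_def)
  ultimately have "east_heights 0 p = east_heights 0 q"
    by (simp add: nth_equalityI)
  then show "p = q"
    using p q by (intro east_heights_inject) (auto simp: rational_dyck_paths_def)
qed

theorem theorem4p6:
  fixes d m :: nat
  assumes "d > 0" and "m > 0"
  shows "\<exists>f. bij_betw f (rational_dyck_paths m d) (rational_dyck_positroids d m)"
  using inj_on_dyck_positroid[OF assms(1)] rational_dyck_positroids_eq[OF assms(1)]
  by (auto simp: bij_betw_def)

end
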